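(* Suppose that $X\subseteq\mathbb{R}^{mn}$ is convex and closed, that the solution set $D^*$ of the problem $\min\{f(x) : x\in X,\ Ax=b\}$ is nonempty, and that $f:\mathbb{R}^{mn}\to\mathbb{R}$ is convex. Let $\{w^k\}$, $w^k=(x^k,y^k)$, be generated by Method (PDM) with index sets $I_k\subseteq L$ and stepsizes $\lambda_k$. Suppose that $$\bigcap_{k=1}^{\infty} W^*_{(k)}\neq\varnothing$$ and that, for some $\tau\in(0,1)$, $$\lambda_k\in\left[\tau,\ \frac{\sqrt{1-\tau}}{\sqrt{2}\,\|A_{(k)}\|}\right]\quad\text{for all } k\ge 1.$$ Then: (i) the sequence $\{w^k\}$ has limit points; (ii) each limit point of $\{w^k\}$ is a saddle point for index set $I$, i.e. belongs to $W^*_I$, for some $I\subseteq L$; (iii) for any limit point $\bar w$ of $\{w^k\}$ such that $\bar w\in\bigcap_{k=1}^{\infty}W^*_{(k)}$ it holds that $\lim_{k\to\infty}w^k=\bar w$.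
   Context: Let $m,n,l$ be positive integers and $L=\{1,\dots,l\}$. Let $X\subseteq\mathbb{R}^{mn}$, $f:\mathbb{R}^{mn}\to\mathbb{R}$, let $A$ be a real matrix with $ln$ rows and $mn$ columns consisting of stacked $n\times mn$ blocks $A_1,\dots,A_l$, and let $b=(b_i)_{i\in L}\in\mathbb{R}^{ln}$ with $b_i\in\mathbb{R}^n$. For $I\subseteq L$, $A_I$ is the matrix of stacked blocks $A_i$, $i\in I$, and $b_I=(b_i)_{i\in I}$ (so $A_L=A$, $b_L=b$; for $I=\varnothing$ the constraint $A_Ix=b_I$ is void). Lagrange function: $\mathcal{L}(x,y)=f(x)+\langle y,Ax-b\rangle$. For $I\subseteq L$ let $Y_I=\{y=(y_i)_{i\in L}\in\mathbb{R}^{ln} : y_i=\mathbf{0}\in\mathbb{R}^n \text{ for } i\notin I\}$. A pair $(x^*,y^* )\in X\times Y_I$ is a saddle point for index set $I$ if $\mathcal{L}(x^*,y)\le\mathcal{L}(x^*,y^* )\le\mathcal{L}(x,y^* )$ for all $y\in Y_I$ and all $x\in X$. $W^*_I$ denotes the set of saddle points for index set $I$; it has the form $W^*_I=D^*_I\times Y^*_I$, where $D^*_I$ is the solution set of $\min\{f(x): x\in X,\ A_Ix=b_I\}$ and $Y^*_I$ is the corresponding set of Lagrange multipliers (dual components of saddle points). Method (PDM): choose $I_0\subseteq L$ and $w^0=(x^0,y^0)\in X\times Y_{I_0}$. For $k=1,2,\dots$ choose $I_k\subseteq L$ and $\lambda_k>0$, and set $p^k=\pi_{Y_{(k)}}[y^{k-1}+\lambda_k(Ax^{k-1}-b)]$,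 $x^k=\operatorname{argmin}\{f(x)+\langle p^k,Ax-b\rangle+0.5\lambda_k^{-1}\|x-x^{k-1}\|^2 : x\in X\}$, $y^k=\pi_{Y_{(k)}}[y^{k-1}+\lambda_k(Ax^k-b)]$, where $\pi_U$ is Euclidean projection onto $U$. The subscript $(k)$ abbreviates $I_k$: $Y_{(k)}=Y_{I_k}$, $A_{(k)}=A_{I_k}$, $W^*_{(k)}=W^*_{I_k}$, etc. $\|\cdot\|$ is the Euclidean norm for vectors and the induced operator norm for matrices; if $\|A_{(k)}\|=0$ the upper bound on $\lambda_k$ is read as $+\infty$ (with $\lambda_k$ finite). A limit point of a sequence is the limit of some convergent subsequence. *)

theory Defs
  imports "HOL-Analysis.Analysis"
begin

text \<open>
  The space of primal vectors, of dimension $mn$, is \<open>real ^ ('m \<times> 'n)\<close>, and the space of dual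
  vectors, of dimension $ln$, is \<open>real ^ ('l \<times> 'n)\<close>; the type \<open>'l\<close> plays the role of the index
  set $L$. The coordinates \<open>(i, j)\<close>, for fixed \<open>i\<close>, form the \<open>i\<close>-th block of a dual vector, and the
  rows \<open>(i, j)\<close> form the \<open>i\<close>-th block of the matrix.
\<close>

definition vec_block :: "real ^ ('l \<times> 'n) \<Rightarrow> 'l::finite \<Rightarrow> real ^ 'n::finite"
  where "vec_block y i = (\<chi> j. y $ (i, j))"

definition mat_block :: "real ^ ('m::finite \<times> 'n) ^ ('l \<times> 'n) \<Rightarrow> 'l::finite \<Rightarrow> real ^ ('m \<times> 'n) ^ 'n::finite"
  where "mat_block A i = (\<chi> j. A $ (i, j))"

text \<open>
  The stacked matrix $A_I$ has a number of rows depending on \<open>I\<close>. It is represented here with the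
  rows of the absent blocks kept as zero rows, that is, its codomain is embedded isometrically into
  the full dual space. This does not affect the operator norm.
\<close>

definition stack :: "real ^ ('m::finite \<times> 'n::finite) ^ ('l::finite \<times> 'n) \<Rightarrow> 'l set \<Rightarrow> real ^ ('m \<times> 'n) ^ ('l \<times> 'n)"
  where "stack A I = (\<chi> r. if fst r \<in> I then A $ r else 0)"

definition opnorm :: "real ^ 'c::finite ^ 'r::finite \<Rightarrow> real"
  where "opnorm M = onorm ((*v) M)"

definition lagrangian ::
  "(real ^ ('m::finite \<times> 'n::finite) \<Rightarrow> real) \<Rightarrow> real ^ ('m \<times> 'n) ^ ('l::finite \<times> 'n) \<Rightarrow> real ^ ('l \<times> 'n)
    \<Rightarrow> real ^ ('m \<times> 'n) \<Rightarrow> real ^ ('l \<times> 'n) \<Rightarrow> real"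
  where "lagrangian f A b x y = f x + y \<bullet> (A *v x - b)"

definition dual_space :: "'l::finite set \<Rightarrow> (real ^ ('l \<times> 'n::finite)) set"
  where "dual_space I = {y. \<forall>i. i \<notin> I \<longrightarrow> vec_block y i = 0}"

definition feasible_set ::
  "(real ^ ('m::finite \<times> 'n::finite)) set \<Rightarrow> real ^ ('m \<times> 'n) ^ ('l::finite \<times> 'n) \<Rightarrow> real ^ ('l \<times> 'n)
    \<Rightarrow> 'l set \<Rightarrow> (real ^ ('m \<times> 'n)) set"
  where "feasible_set X A b I = {x \<in> X. \<forall>i\<in>I. mat_block A i *v x = vec_block b i}"

definition solution_set ::
  "(real ^ ('m::finite \<times> 'n::finite)) set \<Rightarrow> (real ^ ('m \<times> 'n) \<Rightarrow> real) \<Rightarrow> real ^ ('m \<times> 'n) ^ ('l::finite \<times> 'n)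
    \<Rightarrow> real ^ ('l \<times> 'n) \<Rightarrow> 'l set \<Rightarrow> (real ^ ('m \<times> 'n)) set"
  where "solution_set X f A b I = {x. is_arg_min f (\<lambda>x. x \<in> feasible_set X A b I) x}"

definition saddle_points ::
  "(real ^ ('m::finite \<times> 'n::finite)) set \<Rightarrow> (real ^ ('m \<times> 'n) \<Rightarrow> real) \<Rightarrow> real ^ ('m \<times> 'n) ^ ('l::finite \<times> 'n)
    \<Rightarrow> real ^ ('l \<times> 'n) \<Rightarrow> 'l set \<Rightarrow> ((real ^ ('m \<times> 'n)) \<times> (real ^ ('l \<times> 'n))) set"
  where "saddle_points X f A b I =
    {(x', y'). x' \<in> X \<and> y' \<in> dual_space I \<and>
       (\<forall>y\<in>dual_space I. lagrangian f A b x' y \<le> lagrangian f A b x' y') \<and>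
       (\<forall>x\<in>X. lagrangian f A b x' y' \<le> lagrangian f A b x y')}"

definition pdm ::
  "(real ^ ('m::finite \<times> 'n::finite)) set \<Rightarrow> (real ^ ('m \<times> 'n) \<Rightarrow> real) \<Rightarrow> real ^ ('m \<times> 'n) ^ ('l::finite \<times> 'n)
    \<Rightarrow> real ^ ('l \<times> 'n) \<Rightarrow> (nat \<Rightarrow> 'l set) \<Rightarrow> (nat \<Rightarrow> real)
    \<Rightarrow> (nat \<Rightarrow> real ^ ('l \<times> 'n)) \<Rightarrow> (nat \<Rightarrow> real ^ ('m \<times> 'n)) \<Rightarrow> (nat \<Rightarrow> real ^ ('l \<times> 'n)) \<Rightarrow> bool"
  where "pdm X f A b I lam p x y \<longleftrightarrow>
    x 0 \<in> X \<and> y 0 \<in> dual_space (I 0) \<and>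
    (\<forall>k\<ge>1. lam k > 0 \<and>
       p k = closest_point (dual_space (I k)) (y (k - 1) + lam k *\<^sub>R (A *v x (k - 1) - b)) \<and>
       is_arg_min (\<lambda>u. f u + p k \<bullet> (A *v u - b) + 0.5 * inverse (lam k) * (norm (u - x (k - 1)))\<^sup>2)
         (\<lambda>u. u \<in> X) (x k) \<and>
       y k = closest_point (dual_space (I k)) (y (k - 1) + lam k *\<^sub>R (A *v x k - b)))"

definition is_limit_point :: "(nat \<Rightarrow> 'a::topological_space) \<Rightarrow> 'a \<Rightarrow> bool"
  where "is_limit_point w z \<longleftrightarrow> (\<exists>r. strict_mono r \<and> (w \<circ> r) \<longlonglongrightarrow> z)"

end

theory Submission
  imports Defs
begin

text \<open>
  The argument is a Fejer one. Let $(x^*,y^*)$ lie in every $W^*_{(k)}$. In iteration $k$ the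
  proximal step satisfies a three-point inequality (\<open>prox_three_point\<close>), and the two projections
  onto the subspace $Y_{(k)}$ are characterised by orthogonality (\<open>closest_point_subspace_orthogonal\<close>).
  Combining the proximal inequality at $x^*$, the orthogonality of the second projection tested with
  $y^* - y^k$, that of the first one tested with $y^k - p^k$, and the two saddle point inequalities
  gives
  \[ \|w^k - w^*\|^2 \le \|w^{k-1} - w^*\|^2 - \|x^k - x^{k-1}\|^2 - \|p^k - y^{k-1}\|^2
       + \|y^k - p^k\|^2 . \]
  The only bad term is harmless: $y^k - p^k$ is $\lambda_k$ times the projection of
  $A(x^k - x^{k-1})$, so the stepsize bound gives
  $\|y^k - p^k\|^2 \le \frac12 \|x^k - x^{k-1}\|^2$. This is \<open>pdm_step.descent\<close>. The
  point $w^*$ belongs to every $W^*_{(k)}$, so the same distance decreases whatever index sets are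
  chosen.

  The distances $\|w^k - w^*\|$ therefore decrease, which gives a limit point, and
  convergence to any limit point lying in all the $W^*_{(k)}$. The decrements are summable, so
  $x^k - x^{k-1}$, $y^k - p^k$ and $p^k - y^{k-1}$ tend to zero. For a limit point
  $\bar w$, pass to a subsequence on which $I_k$ is one fixed set $J$, which is possible because
  $L$ has finitely many subsets. With $\lambda_k \ge \tau$, the optimality conditions of the steps
  become in the limit the saddle point conditions for $J$.
\<close>

section \<open>Proximal points and projections onto subspaces\<close>

text \<open>
  Compare the minimiser \<open>z\<close> with the points \<open>z + t (x - z)\<close> of the segment towards \<open>x\<close> and let
  \<open>t\<close> tend to zero; the term quadratic in \<open>t\<close> disappears.
\<close>

lemma prox_three_point:
  fixes g :: "'a::real_inner \<Rightarrow> real"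
  assumes "convex_on X g"
    and argmin: "is_arg_min (\<lambda>u. g u + c * (norm (u - a))\<^sup>2) (\<lambda>u. u \<in> X) z"
    and "x \<in> X"
  shows "g z + c * (norm (z - a))\<^sup>2 + c * (norm (x - z))\<^sup>2 \<le> g x + c * (norm (x - a))\<^sup>2"
proof -
  have z: "z \<in> X" and min: "g z + c * (norm (z - a))\<^sup>2 \<le> g u + c * (norm (u - a))\<^sup>2" if "u \<in> X" for u
    using argmin that by (auto simp: is_arg_min_linorder)
  define q where "q = 2 * ((z - a) \<bullet> (x - z))"
  have le: "g z - g x \<le> c * (q + t * (norm (x - z))\<^sup>2)" if t: "0 < t" "t < 1" for t
  proof -
    have u: "(1 - t) *\<^sub>R z + t *\<^sub>R x = z + t *\<^sub>R (x - z)"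
      by (simp add: algebra_simps)
    have "z + t *\<^sub>R (x - z) \<in> X"
      using convexD_alt[of X z x t] convex_on_imp_convex[OF assms(1)] z[OF \<open>x \<in> X\<close>] \<open>x \<in> X\<close> t
      by (simp add: u)
    then have "g z + c * (norm (z - a))\<^sup>2
        \<le> g (z + t *\<^sub>R (x - z)) + c * (norm (z + t *\<^sub>R (x - z) - a))\<^sup>2"
      by (rule min)
    also have "(norm (z + t *\<^sub>R (x - z) - a))\<^sup>2 = (norm (z - a))\<^sup>2 + t * q + t\<^sup>2 * (norm (x - z))\<^sup>2"
      unfolding q_def power2_norm_eq_inner
      by (simp add: algebra_simps power2_eq_square inner_commute)
    also have "g (z + t *\<^sub>R (x - z)) \<le> (1 - t) * g z + t * g x"
      using convex_onD[OF assms(1), of t z x] z[OF \<open>x \<in> X\<close>] \<open>x \<in> X\<close> t by (simp add: u)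
    finally have "t * (g z - g x) \<le> t * (c * (q + t * (norm (x - z))\<^sup>2))"
      by (simp add: algebra_simps power2_eq_square)
    then show ?thesis
      using t by simp
  qed
  have "((\<lambda>t. c * (q + t * (norm (x - z))\<^sup>2)) \<longlongrightarrow> c * (q + 0 * (norm (x - z))\<^sup>2)) (at_right 0)"
    by (intro tendsto_intros)
  moreover have "\<forall>\<^sub>F t in at_right 0. g z - g x \<le> c * (q + t * (norm (x - z))\<^sup>2)"
    using le by (auto simp: eventually_at_right[OF zero_less_one] intro!: exI[of _ 1])
  ultimately have "g z - g x \<le> c * (q + 0 * (norm (x - z))\<^sup>2)"
    by (rule tendsto_lowerbound) simp
  moreover have "q = (norm (x - a))\<^sup>2 - (norm (z - a))\<^sup>2 - (norm (x - z))\<^sup>2"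
    unfolding q_def power2_norm_eq_inner by (simp add: algebra_simps inner_commute)
  ultimately show ?thesis
    by (simp add: algebra_simps)
qed

lemma closest_point_subspace_orthogonal:
  fixes S :: "'a::euclidean_space set"
  assumes "subspace S" and "v \<in> S"
  shows "(a - closest_point S a) \<bullet> v = 0"
proof -
  have cl: "closed S" and cv: "convex S"
    using assms closed_subspace subspace_imp_convex by auto
  have c: "closest_point S a \<in> S"
    using cl assms by (auto intro: closest_point_in_set)
  have "closest_point S a + v \<in> S" "closest_point S a - v \<in> S"
    using assms c by (auto intro: subspace_add subspace_diff)
  from this[THEN closest_point_dot[OF cv cl, of _ a]] show ?thesis
    by simp
qed

section \<open>The dual subspace and the stacked matrix\<close>

lemma dual_space_iff: "y \<in> dual_space I \<longleftrightarrow> (\<forall>r. fst r \<notin> I \<longrightarrow> y $ r = 0)"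
  by (auto simp: dual_space_def vec_block_def vec_eq_iff)

lemma subspace_dual_space: "subspace (dual_space I)"
  by (auto simp: subspace_def dual_space_iff)

lemma stack_mult_inner_dual:
  assumes "v \<in> dual_space I"
  shows "(stack A I *v d) \<bullet> v = (A *v d) \<bullet> v"
  using assms
  by (auto simp: inner_vec_def stack_def matrix_vector_mult_def dual_space_iff intro!: sum.cong)

lemma opnorm_nonneg: "0 \<le> opnorm M"
  unfolding opnorm_def by (intro onorm_pos_le matrix_vector_mul_bounded_linear)

lemma norm_mult_le_opnorm: "norm (M *v d) \<le> opnorm M * norm d"
  unfolding opnorm_def by (rule onorm[OF matrix_vector_mul_bounded_linear])

text \<open>
  For a fixed first component the Lagrangian is affine on the subspace $Y_I$, and an affine
  function that is bounded above on a subspace is constant there.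
\<close>

lemma saddle_point_orthogonal:
  assumes "(x', y') \<in> saddle_points X f A b I" and "v \<in> dual_space I"
  shows "v \<bullet> (A *v x' - b) = 0"
proof -
  have y': "y' \<in> dual_space I"
    and le: "y \<bullet> (A *v x' - b) \<le> y' \<bullet> (A *v x' - b)" if "y \<in> dual_space I" for y
    using assms(1) that by (auto simp: saddle_points_def lagrangian_def)
  have "y' + v \<in> dual_space I" "y' - v \<in> dual_space I"
    using y' assms(2) by (auto simp: dual_space_iff)
  from this[THEN le] show ?thesis
    by (simp add: inner_add_left inner_diff_left)
qed

section \<open>One iteration of the method\<close>

text \<open>
  One iteration leads from \<open>(a, c)\<close> to \<open>(x, y)\<close>, with predictor \<open>p\<close>, index set \<open>J\<close> and
  stepsize \<open>s\<close>.
\<close>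

locale pdm_step =
  fixes X :: "(real ^ ('m::finite \<times> 'n::finite)) set"
    and f :: "real ^ ('m \<times> 'n) \<Rightarrow> real"
    and A :: "real ^ ('m \<times> 'n) ^ ('l::finite \<times> 'n)"
    and b :: "real ^ ('l \<times> 'n)"
    and J :: "'l set" and s :: real
    and a :: "real ^ ('m \<times> 'n)" and c p :: "real ^ ('l \<times> 'n)"
    and x :: "real ^ ('m \<times> 'n)" and y :: "real ^ ('l \<times> 'n)"
  assumes convex_X: "convex X" and convex_f: "convex_on UNIV f"
    and s_pos: "0 < s"
    and p_eq: "p = closest_point (dual_space J) (c + s *\<^sub>R (A *v a - b))"
    and x_argmin: "is_arg_min
      (\<lambda>u. f u + p \<bullet> (A *v u - b) + 0.5 * inverse s * (norm (u - a))\<^sup>2) (\<lambda>u. u \<in> X) x"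
    and y_eq: "y = closest_point (dual_space J) (c + s *\<^sub>R (A *v x - b))"
begin

lemma x_in: "x \<in> X"
  using x_argmin by (simp add: is_arg_min_def)

lemma p_in: "p \<in> dual_space J" and y_in: "y \<in> dual_space J"
  unfolding p_eq y_eq using subspace_dual_space[of J]
  by (auto intro!: closest_point_in_set closed_subspace dest: subspace_0)

lemma p_orthogonal: "v \<in> dual_space J \<Longrightarrow> (p - c) \<bullet> v = s * ((A *v a - b) \<bullet> v)"
  using closest_point_subspace_orthogonal[OF subspace_dual_space, of v J "c + s *\<^sub>R (A *v a - b)"]
  unfolding p_eq[symmetric] by (simp add: algebra_simps)

lemma y_orthogonal: "v \<in> dual_space J \<Longrightarrow> (y - c) \<bullet> v = s * ((A *v x - b) \<bullet> v)"
  using closest_point_subspace_orthogonal[OF subspace_dual_space, of v J "c + s *\<^sub>R (A *v x - b)"]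
  unfolding y_eq[symmetric] by (simp add: algebra_simps)

lemma lagrangian_prox:
  assumes "u \<in> X"
  shows "2 * s * (lagrangian f A b x p - lagrangian f A b u p)
    \<le> (norm (u - a))\<^sup>2 - (norm (u - x))\<^sup>2 - (norm (x - a))\<^sup>2"
proof -
  have "convex_on X f"
    using convex_f convex_X by (auto intro: convex_on_subset)
  moreover have "convex_on X (\<lambda>u. p \<bullet> (A *v u - b))"
    using convex_X by (auto simp: convex_on_def matrix_vector_right_distrib
        matrix_vector_mult_scaleR inner_add_right inner_diff_right algebra_simps
        simp flip: distrib_right)
  ultimately have "convex_on X (\<lambda>u. f u + p \<bullet> (A *v u - b))"
    by (rule convex_on_add)
  from prox_three_point[OF this x_argmin assms]
  have "lagrangian f A b x p - lagrangian f A b u p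
      \<le> 0.5 * inverse s * ((norm (u - a))\<^sup>2 - (norm (u - x))\<^sup>2 - (norm (x - a))\<^sup>2)"
    by (simp add: lagrangian_def algebra_simps)
  with s_pos show ?thesis
    by (simp add: field_simps)
qed

text \<open>
  The corrector and the predictor project points that differ by $s A (x - a)$, and only the part
  of this difference in the subspace, that is $s A_J (x - a)$, survives the projection.
\<close>

lemma correction_orthogonal:
  "v \<in> dual_space J \<Longrightarrow> (y - p) \<bullet> v = s * ((A *v (x - a)) \<bullet> v)"
  using p_orthogonal[of v] y_orthogonal[of v]
  by (simp add: algebra_simps matrix_vector_mult_diff_distrib)

lemma norm_correction_le: "norm (y - p) \<le> s * opnorm (stack A J) * norm (x - a)"
proof (cases "y = p")
  case True
  then show ?thesis
    using s_pos opnorm_nonneg[of "stack A J"] by simp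
next
  case False
  have yp: "y - p \<in> dual_space J"
    using y_in p_in subspace_dual_space by (auto intro: subspace_diff)
  have "norm (y - p) * norm (y - p) = s * ((stack A J *v (x - a)) \<bullet> (y - p))"
    using correction_orthogonal[OF yp]
    by (simp add: stack_mult_inner_dual[OF yp] power2_norm_eq_inner flip: power2_eq_square)
  also have "\<dots> \<le> s * (norm (stack A J *v (x - a)) * norm (y - p))"
    using s_pos by (intro mult_left_mono norm_cauchy_schwarz) auto
  also have "\<dots> \<le> s * ((opnorm (stack A J) * norm (x - a)) * norm (y - p))"
    using s_pos by (intro mult_left_mono mult_right_mono norm_mult_le_opnorm) auto
  finally have "norm (y - p) * norm (y - p)
      \<le> (s * opnorm (stack A J) * norm (x - a)) * norm (y - p)"
    by (simp add: mult.assoc)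
  with False show ?thesis
    by simp
qed

text \<open>
  The proximal inequality at \<open>x'\<close> bounds $2s\langle p - y', Ax - b\rangle$ by means of the saddle point
  inequalities. Split this as $2s\langle p - y, Ax - b\rangle + 2s\langle y - y', Ax - b\rangle$: the second
  part is a difference of squared distances because \<open>y\<close> is a projection. In the first part, replacing
  \<open>x\<close> by \<open>a\<close> costs $2s\langle p - y, A(x - a)\rangle = -2\|y - p\|^2$ and leaves an expression
  in which \<open>p\<close> is the projection.
\<close>

lemma fejer_inequality:
  assumes saddle: "(x', y') \<in> saddle_points X f A b J"
  shows "(norm (x - x'))\<^sup>2 + (norm (y - y'))\<^sup>2 + (norm (x - a))\<^sup>2 + (norm (p - c))\<^sup>2
    \<le> (norm (a - x'))\<^sup>2 + (norm (c - y'))\<^sup>2 + (norm (y - p))\<^sup>2"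
proof -
  have x': "x' \<in> X" and y': "y' \<in> dual_space J"
    and "lagrangian f A b x' p \<le> lagrangian f A b x' y'"
    and "lagrangian f A b x' y' \<le> lagrangian f A b x y'"
    using saddle p_in x_in by (auto simp: saddle_points_def)
  then have "(p - y') \<bullet> (A *v x - b) \<le> lagrangian f A b x p - lagrangian f A b x' p"
    by (simp add: lagrangian_def inner_diff_left)
  then have "2 * s * ((p - y') \<bullet> (A *v x - b))
      \<le> 2 * s * (lagrangian f A b x p - lagrangian f A b x' p)"
    using s_pos by (intro mult_left_mono) auto
  also note lagrangian_prox[OF x']
  finally have primal: "2 * s * ((A *v x - b) \<bullet> (p - y'))
      \<le> (norm (x' - a))\<^sup>2 - (norm (x' - x))\<^sup>2 - (norm (x - a))\<^sup>2"
    by (simp add: inner_commute)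
  have in_dual: "y' - y \<in> dual_space J" "y - p \<in> dual_space J"
    using y' y_in p_in subspace_dual_space by (auto intro: subspace_diff)
  note corrector = y_orthogonal[OF in_dual(1)]
    and predictor = p_orthogonal[OF in_dual(2)]
    and correction = correction_orthogonal[OF in_dual(2)]
  have "s * ((A *v x - b) \<bullet> (p - y')) = - (s * ((A *v x - b) \<bullet> (y' - y)))
      - s * ((A *v a - b) \<bullet> (y - p)) - s * ((A *v (x - a)) \<bullet> (y - p))"
    by (simp add: matrix_vector_mult_diff_distrib algebra_simps)
  also have "\<dots> = - ((y - c) \<bullet> (y' - y)) - (p - c) \<bullet> (y - p) - (y - p) \<bullet> (y - p)"
    by (simp only: corrector predictor correction)
  finally have "2 * s * ((A *v x - b) \<bullet> (p - y'))
      = 2 * (- ((y - c) \<bullet> (y' - y)) - (p - c) \<bullet> (y - p) - (y - p) \<bullet> (y - p))"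
    by simp
  also have "\<dots> = (norm (y - y'))\<^sup>2 - (norm (c - y'))\<^sup>2 + (norm (p - c))\<^sup>2 - (norm (y - p))\<^sup>2"
    unfolding power2_norm_eq_inner by (simp add: algebra_simps inner_commute)
  finally show ?thesis
    using primal by (simp add: norm_minus_commute)
qed

lemma descent:
  assumes "(x', y') \<in> saddle_points X f A b J"
    and "(s * opnorm (stack A J))\<^sup>2 \<le> 1 / 2"
  shows "(dist (x, y) (x', y'))\<^sup>2 + (norm (x - a))\<^sup>2 / 2 + (norm (p - c))\<^sup>2
    \<le> (dist (a, c) (x', y'))\<^sup>2"
    and "(norm (y - p))\<^sup>2 \<le> (norm (x - a))\<^sup>2 / 2"
proof -
  have "(norm (y - p))\<^sup>2 \<le> (s * opnorm (stack A J) * norm (x - a))\<^sup>2"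
    by (intro power_mono norm_correction_le) auto
  also have "\<dots> \<le> 1 / 2 * (norm (x - a))\<^sup>2"
    unfolding power_mult_distrib[of _ "norm (x - a)"] by (intro mult_right_mono assms) auto
  finally show yp: "(norm (y - p))\<^sup>2 \<le> (norm (x - a))\<^sup>2 / 2"
    by simp
  then show "(dist (x, y) (x', y'))\<^sup>2 + (norm (x - a))\<^sup>2 / 2 + (norm (p - c))\<^sup>2
      \<le> (dist (a, c) (x', y'))\<^sup>2"
    using fejer_inequality[OF assms(1)] unfolding dist_Pair_Pair by (simp add: dist_norm)
qed

end

text \<open>
  This form of the stepsize condition also covers a vanishing matrix, where the stepsize is
  unbounded.
\<close>

lemma stepsize_opnorm_le:
  assumes "0 < \<tau>" "\<tau> < 1" "0 < s"
    and "opnorm M \<noteq> 0 \<Longrightarrow> s \<le> sqrt (1 - \<tau>) / (sqrt 2 * opnorm M)"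
  shows "(s * opnorm M)\<^sup>2 \<le> 1 / 2"
proof (cases "opnorm M = 0")
  case False
  then have "0 < opnorm M"
    using opnorm_nonneg[of M] by simp
  then have "s * opnorm M \<le> sqrt (1 - \<tau>) / sqrt 2"
    using assms(4) by (simp add: field_simps)
  then have "(s * opnorm M)\<^sup>2 \<le> (sqrt (1 - \<tau>) / sqrt 2)\<^sup>2"
    using assms(3) opnorm_nonneg[of M] by (intro power_mono) auto
  also have "\<dots> = (1 - \<tau>) / 2"
    using assms by (simp add: power_divide)
  finally show ?thesis
    using assms(1) by simp
qed simp

section \<open>Passing to the limit\<close>

lemma tendsto_zero_of_descent:
  fixes d r :: "nat \<Rightarrow> real"
  assumes "\<And>k. 0 \<le> r k" and "\<And>k. 0 \<le> d k" and "\<And>k. r (Suc k) + d k \<le> r k"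
  shows "d \<longlonglongrightarrow> 0"
proof -
  have "decseq r"
    using assms by (intro decseq_SucI) (metis order_trans le_add_same_cancel1)
  then obtain R where "r \<longlonglongrightarrow> R"
    using decseq_convergent[of r 0] assms(1) by blast
  then have "(\<lambda>k. r k - r (Suc k)) \<longlonglongrightarrow> R - R"
    by (intro tendsto_diff LIMSEQ_Suc)
  then show ?thesis
    using assms by (intro tendsto_sandwich[of "\<lambda>_. 0" d _ "\<lambda>k. r k - r (Suc k)"])
      (auto simp: algebra_simps)
qed

lemma tendsto_of_limit_point_decseq_dist:
  fixes w :: "nat \<Rightarrow> 'a::metric_space"
  assumes "is_limit_point w z" and dec: "decseq (\<lambda>k. dist (w k) z)"
  shows "w \<longlonglongrightarrow> z"
proof -
  obtain r where "strict_mono r" "(w \<circ> r) \<longlonglongrightarrow> z"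
    using assms(1) by (auto simp: is_limit_point_def)
  show ?thesis
  proof (rule metric_LIMSEQ_I)
    fix e :: real
    assume "0 < e"
    then obtain j where "dist (w (r j)) z < e"
      using metric_LIMSEQ_D[OF \<open>(w \<circ> r) \<longlonglongrightarrow> z\<close>] by (auto simp: comp_def)
    then have "\<forall>k\<ge>r j. dist (w k) z < e"
      using dec by (auto simp: decseq_def intro: le_less_trans)
    then show "\<exists>n. \<forall>k\<ge>n. dist (w k) z < e"
      by blast
  qed
qed

lemma subseq_constant:
  fixes g :: "nat \<Rightarrow> 'a::finite"
  obtains q :: "nat \<Rightarrow> nat" and c where "strict_mono q" and "\<And>j. g (q j) = c"
proof -
  obtain c where "infinite {n. g n = c}"
    using pigeonhole_infinite[of "UNIV :: nat set" g] by auto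
  then show ?thesis
    using that[of "enumerate {n. g n = c}" c] strict_mono_enumerate enumerate_in_set[of "{n. g n = c}"]
    by simp
qed

text \<open>
  A limit of iterations that all use the index set \<open>J\<close> and move less and less is a saddle point
  for \<open>J\<close>. The displacements enter the optimality conditions divided by the stepsize; the lower
  bound \<open>\<tau>\<close> on the stepsizes keeps these quotients small.
\<close>

lemma saddle_point_limit:
  fixes X :: "(real ^ ('m::finite \<times> 'n::finite)) set"
    and A :: "real ^ ('m \<times> 'n) ^ ('l::finite \<times> 'n)"
  assumes step: "\<And>j. pdm_step X f A b J (s j) (a j) (c j) (p j) (x j) (y j)"
    and "closed X" and "0 < \<tau>" and s: "\<And>j. \<tau> \<le> s j"
    and x: "x \<longlonglongrightarrow> x'" and y: "y \<longlonglongrightarrow> y'"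
    and xa: "(\<lambda>j. x j - a j) \<longlonglongrightarrow> 0" and yp: "(\<lambda>j. y j - p j) \<longlonglongrightarrow> 0"
    and pc: "(\<lambda>j. p j - c j) \<longlonglongrightarrow> 0"
  shows "(x', y') \<in> saddle_points X f A b J"
proof -
  have x'_in: "x' \<in> X"
    using closed_sequentially[OF \<open>closed X\<close> _ x] pdm_step.x_in[OF step] by blast
  have y'_in: "y' \<in> dual_space J"
    using closed_sequentially[OF closed_subspace[OF subspace_dual_space] _ y]
      pdm_step.y_in[OF step] by blast
  have s_inv: "inverse (s j) \<le> inverse \<tau>" "0 < s j" for j
    using s[of j] \<open>0 < \<tau>\<close> by (auto intro: le_imp_inverse_le)
  have a: "a \<longlonglongrightarrow> x'" and p: "p \<longlonglongrightarrow> y'"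
    using tendsto_diff[OF x xa] tendsto_diff[OF y yp] by simp_all
  have yc: "(\<lambda>j. y j - c j) \<longlonglongrightarrow> 0"
    using tendsto_add[OF yp pc] by simp
  note lim = tendsto_intros bounded_linear.tendsto[OF matrix_vector_mul_bounded_linear]
  have feasible: "v \<bullet> (A *v x' - b) = 0" if v: "v \<in> dual_space J" for v
  proof -
    have eq: "(A *v x j - b) \<bullet> v = inverse (s j) * ((y j - c j) \<bullet> v)" for j
      using pdm_step.y_orthogonal[OF step v, of j] s_inv(2)[of j] by (simp add: field_simps)
    have "(\<lambda>j. inverse \<tau> * \<bar>(y j - c j) \<bullet> v\<bar>) \<longlonglongrightarrow> inverse \<tau> * \<bar>0 \<bullet> v\<bar>"
      by (intro lim yc)
    then have "(\<lambda>j. inverse \<tau> * \<bar>(y j - c j) \<bullet> v\<bar>) \<longlonglongrightarrow> 0"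
      by simp
    moreover have "norm ((A *v x j - b) \<bullet> v) \<le> inverse \<tau> * \<bar>(y j - c j) \<bullet> v\<bar>" for j
      unfolding eq using s_inv[of j] by (auto simp: abs_mult intro!: mult_right_mono)
    ultimately have "(\<lambda>j. (A *v x j - b) \<bullet> v) \<longlonglongrightarrow> 0"
      by (auto intro: Lim_null_comparison[rotated])
    moreover have "(\<lambda>j. (A *v x j - b) \<bullet> v) \<longlonglongrightarrow> (A *v x' - b) \<bullet> v"
      by (intro lim x)
    ultimately show ?thesis
      by (subst inner_commute) (rule LIMSEQ_unique)
  qed
  have optimal: "lagrangian f A b x' y' \<le> lagrangian f A b u y'" if u: "u \<in> X" for u
  proof -
    have "continuous_on UNIV f"
      using pdm_step.convex_f[OF step] by (intro convex_on_continuous) auto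
    then have "isCont f x'"
      by (simp add: continuous_on_eq_continuous_at)
    then have f: "(\<lambda>j. f (x j)) \<longlonglongrightarrow> f x'"
      using x by (rule isCont_tendsto_compose)
    define e where "e j = (norm (u - a j))\<^sup>2 - (norm (u - x j))\<^sup>2" for j
    have "lagrangian f A b (x j) (p j) \<le> lagrangian f A b u (p j) + inverse \<tau> * \<bar>e j\<bar>" for j
    proof -
      have "2 * s j * (lagrangian f A b (x j) (p j) - lagrangian f A b u (p j)) \<le> e j"
        using pdm_step.lagrangian_prox[OF step u, of j] zero_le_power2[of "norm (x j - a j)"]
        unfolding e_def by linarith
      also have "\<dots> \<le> 2 * \<bar>e j\<bar>"
        by simp
      finally have "lagrangian f A b (x j) (p j) - lagrangian f A b u (p j) \<le> inverse (s j) * \<bar>e j\<bar>"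
        using s_inv(2)[of j] by (simp add: field_simps)
      also have "\<dots> \<le> inverse \<tau> * \<bar>e j\<bar>"
        using s_inv by (intro mult_right_mono) auto
      finally show ?thesis
        by simp
    qed
    moreover have "(\<lambda>j. lagrangian f A b (x j) (p j)) \<longlonglongrightarrow> lagrangian f A b x' y'"
      unfolding lagrangian_def by (intro lim f x p)
    moreover have "(\<lambda>j. lagrangian f A b u (p j) + inverse \<tau> * \<bar>e j\<bar>)
        \<longlonglongrightarrow> lagrangian f A b u y' + inverse \<tau> * \<bar>(norm (u - x'))\<^sup>2 - (norm (u - x'))\<^sup>2\<bar>"
      unfolding lagrangian_def e_def by (intro lim a x p)
    ultimately show ?thesis
      by simp (rule LIMSEQ_le, auto)
  qed
  show ?thesis
    using x'_in y'_in feasible optimal by (auto simp: saddle_points_def lagrangian_def)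
qed

section \<open>Convergence of the method\<close>

theorem theorem1:
  fixes X :: "(real ^ ('m::finite \<times> 'n::finite)) set"
    and f :: "real ^ ('m \<times> 'n) \<Rightarrow> real"
    and A :: "real ^ ('m \<times> 'n) ^ ('l::finite \<times> 'n)"
    and b :: "real ^ ('l \<times> 'n)"
    and I :: "nat \<Rightarrow> 'l set"
    and lam :: "nat \<Rightarrow> real"
    and p y :: "nat \<Rightarrow> real ^ ('l \<times> 'n)"
    and x :: "nat \<Rightarrow> real ^ ('m \<times> 'n)"
    and w :: "nat \<Rightarrow> (real ^ ('m \<times> 'n)) \<times> (real ^ ('l \<times> 'n))"
    and \<tau> :: real
  assumes "convex X" and "closed X"
    and "solution_set X f A b UNIV \<noteq> {}"
    and "convex_on UNIV f"
    and "pdm X f A b I lam p x y"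
    and "w = (\<lambda>k. (x k, y k))"
    and "(\<Inter>k\<in>{1..}. saddle_points X f A b (I k)) \<noteq> {}"
    and "0 < \<tau>" and "\<tau> < 1"
    and "\<And>k. k \<ge> 1 \<Longrightarrow> \<tau> \<le> lam k"
    and "\<And>k. k \<ge> 1 \<Longrightarrow> opnorm (stack A (I k)) \<noteq> 0 \<Longrightarrow>
           lam k \<le> sqrt (1 - \<tau>) / (sqrt 2 * opnorm (stack A (I k)))"
  shows "(\<exists>z. is_limit_point w z) \<and>
    (\<forall>z. is_limit_point w z \<longrightarrow> (\<exists>J. z \<in> saddle_points X f A b J)) \<and>
    (\<forall>z. is_limit_point w z \<and> z \<in> (\<Inter>k\<in>{1..}. saddle_points X f A b (I k)) \<longrightarrow> w \<longlonglongrightarrow> z)"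
proof -
  have step: "pdm_step X f A b (I (Suc k)) (lam (Suc k)) (x k) (y k) (p (Suc k)) (x (Suc k)) (y (Suc k))"
    for k
    using assms(1,4,5) unfolding pdm_def pdm_step_def by (auto dest!: spec[of _ "Suc k"])
  have size: "(lam (Suc k) * opnorm (stack A (I (Suc k))))\<^sup>2 \<le> 1 / 2" for k
    using assms(8-11) pdm_step.s_pos[OF step[of k]] by (intro stepsize_opnorm_le[of \<tau>]) auto
  have common: "(fst z, snd z) \<in> saddle_points X f A b (I (Suc k))"
    if "z \<in> (\<Inter>k\<in>{1..}. saddle_points X f A b (I k))" for z k
    using that by auto
  have descent: "(dist (w (Suc k)) z)\<^sup>2
      + ((norm (x (Suc k) - x k))\<^sup>2 / 2 + (norm (p (Suc k) - y k))\<^sup>2) \<le> (dist (w k) z)\<^sup>2"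
    if "z \<in> (\<Inter>k\<in>{1..}. saddle_points X f A b (I k))" for z k
    using pdm_step.descent(1)[OF step common[OF that] size, of k]
    by (simp add: assms(6) add.assoc)
  have dec: "decseq (\<lambda>k. dist (w k) z)"
    if "z \<in> (\<Inter>k\<in>{1..}. saddle_points X f A b (I k))" for z
  proof (rule decseq_SucI)
    fix k
    have "0 \<le> (norm (x (Suc k) - x k))\<^sup>2 / 2 + (norm (p (Suc k) - y k))\<^sup>2"
      by simp
    with descent[OF that, of k] have "(dist (w (Suc k)) z)\<^sup>2 \<le> (dist (w k) z)\<^sup>2"
      by linarith
    then show "dist (w (Suc k)) z \<le> dist (w k) z"
      by (rule power2_le_imp_le) simp
  qed
  obtain z0 where z0: "z0 \<in> (\<Inter>k\<in>{1..}. saddle_points X f A b (I k))"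
    using assms(7) by blast

  have "\<exists>z. is_limit_point w z"
  proof -
    have "w k \<in> cball z0 (dist (w 0) z0)" for k
      using decseqD[OF dec[OF z0], of 0 k] by (simp add: dist_commute)
    then show ?thesis
      using compact_cball[of z0 "dist (w 0) z0"]
      unfolding compact_def is_limit_point_def by blast
  qed

  have decrement: "(\<lambda>k. (norm (x (Suc k) - x k))\<^sup>2 / 2 + (norm (p (Suc k) - y k))\<^sup>2) \<longlonglongrightarrow> 0"
    using descent[OF z0]
    by (intro tendsto_zero_of_descent[where r = "\<lambda>k. (dist (w k) z0)\<^sup>2"]) auto
  have small: "h \<longlonglongrightarrow> 0"
    if "\<And>k. (norm (h k))\<^sup>2 \<le> 2 * ((norm (x (Suc k) - x k))\<^sup>2 / 2 + (norm (p (Suc k) - y k))\<^sup>2)"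
    for h :: "nat \<Rightarrow> 'z::real_normed_vector"
  proof -
    have "(\<lambda>k. (norm (h k))\<^sup>2) \<longlonglongrightarrow> 0"
      using that tendsto_mult_right_zero[OF decrement, of 2]
      by (intro tendsto_sandwich[of "\<lambda>_. 0" "\<lambda>k. (norm (h k))\<^sup>2"]) auto
    then show ?thesis
      by (simp add: tendsto_norm_zero_iff)
  qed
  have xx: "(\<lambda>k. x (Suc k) - x k) \<longlonglongrightarrow> 0" and py: "(\<lambda>k. p (Suc k) - y k) \<longlonglongrightarrow> 0"
    by (rule small, simp)+
  have yp: "(\<lambda>k. y (Suc k) - p (Suc k)) \<longlonglongrightarrow> 0"
  proof (rule small)
    fix k
    show "(norm (y (Suc k) - p (Suc k)))\<^sup>2
        \<le> 2 * ((norm (x (Suc k) - x k))\<^sup>2 / 2 + (norm (p (Suc k) - y k))\<^sup>2)"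
      using pdm_step.descent(2)[OF step common[OF z0] size, of k]
      by (smt (verit) field_sum_of_halves zero_le_power2)
  qed

  have "\<exists>J. z \<in> saddle_points X f A b J" if "is_limit_point w z" for z
  proof -
    obtain r where r: "strict_mono r" "(w \<circ> r) \<longlonglongrightarrow> z"
      using \<open>is_limit_point w z\<close> by (auto simp: is_limit_point_def)
    obtain q :: "nat \<Rightarrow> nat" and J where q: "strict_mono q" and J: "\<And>j. I (r (Suc (q j))) = J"
      by (rule subseq_constant[of "\<lambda>j. I (r (Suc j))"]) blast
    (* The shift by one makes every index positive, so that w (Suc (n j)) comes from an iteration. *)
    define n where "n j = r (Suc (q j)) - 1" for j
    have n: "Suc (n j) = r (Suc (q j))" for j
      using seq_suble[OF r(1), of "Suc (q j)"] by (simp add: n_def)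
    have "strict_mono n"
    proof (rule strict_monoI)
      fix i j :: nat
      assume "i < j"
      then have "Suc (n i) < Suc (n j)"
        unfolding n using r(1) q by (simp add: strict_mono_less)
      then show "n i < n j"
        by simp
    qed
    have "strict_mono (\<lambda>j. Suc (q j))"
      using q by (simp add: strict_mono_def)
    from LIMSEQ_subseq_LIMSEQ[OF r(2) this] have "(\<lambda>j. w (Suc (n j))) \<longlonglongrightarrow> z"
      by (simp add: comp_def n)
    from tendsto_fst[OF this] tendsto_snd[OF this]
    have "(\<lambda>j. x (Suc (n j))) \<longlonglongrightarrow> fst z" "(\<lambda>j. y (Suc (n j))) \<longlonglongrightarrow> snd z"
      by (simp_all add: assms(6))
    moreover note xx[THEN LIMSEQ_subseq_LIMSEQ, OF \<open>strict_mono n\<close>, unfolded comp_def]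
      py[THEN LIMSEQ_subseq_LIMSEQ, OF \<open>strict_mono n\<close>, unfolded comp_def]
      yp[THEN LIMSEQ_subseq_LIMSEQ, OF \<open>strict_mono n\<close>, unfolded comp_def]
    moreover have "pdm_step X f A b J (lam (Suc (n j))) (x (n j)) (y (n j)) (p (Suc (n j)))
        (x (Suc (n j))) (y (Suc (n j)))" for j
      using step[of "n j"] J[of j] by (simp add: n)
    moreover have "\<tau> \<le> lam (Suc (n j))" for j
      using assms(10) by simp
    ultimately have "(fst z, snd z) \<in> saddle_points X f A b J"
      using \<open>closed X\<close> \<open>0 < \<tau>\<close> by (intro saddle_point_limit)
    then show ?thesis
      by auto
  qed

  moreover have "w \<longlonglongrightarrow> z"
    if "is_limit_point w z" "z \<in> (\<Inter>k\<in>{1..}. saddle_points X f A b (I k))" for z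
    using that dec by (intro tendsto_of_limit_point_decseq_dist)
  ultimately show ?thesis
    using \<open>\<exists>z. is_limit_point w z\<close> by blast
qed

end
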